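(* The following two statements are equivalent. (a) For every bid profile $\mathcal{C}=\{c_l\}_{l\in L}$ and every set of participating bidders $R\subseteq L$, the VCG outcome $u^{\mathrm{VCG}}(\mathcal{C}_R)$ lies in $Core(\mathcal{C}_R)$. (b) The objective function $J$ is supermodular, i.e. for every bid profile $\mathcal{C}$ the set function $S\mapsto J(\mathcal{C}_S)$ on $2^L$ is supermodular.
   Context: Reverse auction. $L=\{1,\dots,|L|\}$ is a finite set of bidders, $t$ is the number of types of goods, and $d:\mathbb{R}_+^{t|L|}\times\mathbb{R}^p\to\mathbb{R}$, $g:\mathbb{R}_+^{t|L|}\times\mathbb{R}^p\to\mathbb{R}^q$ are given functions (extra cost and constraints). A bid profile is a family $\mathcal{C}=\{c_l\}_{l\in L}$ of nondecreasing functions $c_l:\mathbb{R}_+^t\to\mathbb{R}_+$ with $c_l(0)=0$. For $S\subseteq L$, $$J(\mathcal{C}_S)=\min_{x,y}\ \sum_{l\in S}c_l(x_l)+d(x,y)\quad\text{s.t. } g(x,y)\le 0,\ x_l=0\ \ \forall l\in L\setminus S,$$ with $x=(x_l)_{l\in L}\in\mathbb{R}_+^{t|L|}$ and $y\in\mathbb{R}^p$. All bid profiles considered are such that these minima are finite and attained for all $S\subseteq L$ (so the VCG mechanism is well defined for every participating set). VCG outcome (truthful bids, Clarke pivot rule) for participants $R\subseteq L$: the vector $u^{\mathrm{VCG}}(\mathcal{C}_R)\in\mathbb{R}\times\mathbb{R}_+^{|R|}$ with $u_l=J(\mathcal{C}_{R\setminus\{l\}})-J(\mathcal{C}_R)$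 for $l\in R$ and $u_0=-J(\mathcal{C}_R)-\sum_{l\in R}u_l$ (index $0$ is the central operator). Core: $$Core(\mathcal{C}_R)=\Big\{u\in\mathbb{R}\times\mathbb{R}_+^{|R|}\ \Big|\ u_0+\sum_{l\in R}u_l=-J(\mathcal{C}_R),\ u_0+\sum_{l\in S}u_l\ge -J(\mathcal{C}_S)\ \ \forall S\subset R\Big\}.$$ A function $f:2^L\to\mathbb{R}$ is supermodular if $f(S)-f(S\setminus\{l\})\le f(R)-f(R\setminus\{l\})$ for all $S\subseteq R\subseteq L$ and $l\in S$; equivalently $f(S\cup R)+f(S\cap R)\ge f(S)+f(R)$ for all $S,R\subseteq L$. *)

theory Defs
  imports "HOL-Analysis.Analysis"
begin

text \<open>
  The bidders are the elements of a finite type \<open>'l\<close> (so the set of all bidders is \<open>UNIV\<close>) and the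
  types of goods those of a finite type \<open>'t\<close>; an allocation is \<open>x :: real^'t^'l\<close>. The order on
  vectors is componentwise. Bids and the extra cost and constraint functions \<open>d\<close>, \<open>g\<close> are total
  functions, but only their values at nonnegative allocations are ever used.
\<close>

definition feasible ::
  "(real^'t^'l \<Rightarrow> real^'p \<Rightarrow> real^'q) \<Rightarrow> 'l set \<Rightarrow> (real^'t^'l) \<times> (real^'p) \<Rightarrow> bool"
where
  "feasible g S = (\<lambda>(x, y). 0 \<le> x \<and> g x y \<le> 0 \<and> (\<forall>l. l \<notin> S \<longrightarrow> x $ l = 0))"

definition cost ::
  "(real^'t^'l \<Rightarrow> real^'p \<Rightarrow> real) \<Rightarrow> ('l \<Rightarrow> real^'t \<Rightarrow> real) \<Rightarrow> 'l set \<Rightarrow> (real^'t^'l) \<times> (real^'p) \<Rightarrow> real"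
where
  "cost d C S = (\<lambda>(x, y). (\<Sum>l\<in>S. C l (x $ l)) + d x y)"

text \<open>The minimum value; meaningful only if the minimum is attained, as \<open>bid_profile\<close> requires.\<close>

definition J ::
  "(real^'t^'l \<Rightarrow> real^'p \<Rightarrow> real) \<Rightarrow> (real^'t^'l \<Rightarrow> real^'p \<Rightarrow> real^'q)
    \<Rightarrow> ('l \<Rightarrow> real^'t \<Rightarrow> real) \<Rightarrow> 'l set \<Rightarrow> real"
where
  "J d g C S = cost d C S (arg_min (cost d C S) (feasible g S))"

definition bid_profile ::
  "(real^'t^'l \<Rightarrow> real^'p \<Rightarrow> real) \<Rightarrow> (real^'t^'l \<Rightarrow> real^'p \<Rightarrow> real^'q)
    \<Rightarrow> ('l \<Rightarrow> real^'t \<Rightarrow> real) \<Rightarrow> bool"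
where
  "bid_profile d g C \<longleftrightarrow>
     (\<forall>l. mono_on {0..} (C l) \<and> C l ` {0..} \<subseteq> {0..} \<and> C l 0 = 0) \<and>
     (\<forall>S. \<exists>z. is_arg_min (cost d C S) (feasible g S) z)"

text \<open>
  An outcome for participants \<open>R\<close> is a pair of the operator's utility (index 0 in the usual
  notation) and the vector of the bidders' utilities. The latter is a function on \<open>R\<close>,
  i.e. \<open>undefined\<close> outside \<open>R\<close>.
\<close>

definition vcg_outcome ::
  "(real^'t^'l \<Rightarrow> real^'p \<Rightarrow> real) \<Rightarrow> (real^'t^'l \<Rightarrow> real^'p \<Rightarrow> real^'q)
    \<Rightarrow> ('l \<Rightarrow> real^'t \<Rightarrow> real) \<Rightarrow> 'l set \<Rightarrow> real \<times> ('l \<Rightarrow> real)"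
where
  "vcg_outcome d g C R =
     (let u = (\<lambda>l\<in>R. J d g C (R - {l}) - J d g C R)
      in (- J d g C R - (\<Sum>l\<in>R. u l), u))"

definition core ::
  "(real^'t^'l \<Rightarrow> real^'p \<Rightarrow> real) \<Rightarrow> (real^'t^'l \<Rightarrow> real^'p \<Rightarrow> real^'q)
    \<Rightarrow> ('l \<Rightarrow> real^'t \<Rightarrow> real) \<Rightarrow> 'l set \<Rightarrow> (real \<times> ('l \<Rightarrow> real)) set"
where
  "core d g C R =
     {(u0, u). u \<in> R \<rightarrow>\<^sub>E {0..} \<and>
        u0 + (\<Sum>l\<in>R. u l) = - J d g C R \<and>
        (\<forall>S. S \<subset> R \<longrightarrow> u0 + (\<Sum>l\<in>S. u l) \<ge> - J d g C S)}"

definition supermodular :: "('l set \<Rightarrow> real) \<Rightarrow> bool" where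
  "supermodular f \<longleftrightarrow>
     (\<forall>S R l. S \<subseteq> R \<and> l \<in> S \<longrightarrow> f S - f (S - {l}) \<le> f R - f (R - {l}))"

end

(* The equivalence holds for each bid profile separately. Summing marginal losses of J one bidder
   at a time turns supermodularity into the core inequalities for R; conversely, the core
   inequality of the coalition R - {i, j} is the supermodular inequality for adding i and j, and
   these local inequalities imply supermodularity. *)
theory Submission
  imports Defs
begin

text \<open>Remove the bidders of \<open>K\<close> from \<open>R\<close> one at a time. By
  supermodularity, each removal from an already reduced set raises \<open>f\<close> by at least as
  much as the same removal from the full set \<open>R\<close>, and the raises along the way
  telescope to the right-hand side.\<close>

lemma supermodular_sum_marginal_le:
  assumes f: "supermodular f" and "finite K" "K \<subseteq> R"
  shows "(\<Sum>l\<in>K. f (R - {l}) - f R) \<le> f (R - K) - f R"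
  using \<open>finite K\<close> \<open>K \<subseteq> R\<close>
proof (induction K rule: finite_induct)
  case empty
  then show ?case by simp
next
  case (insert k K)
  \<comment> \<open>Supermodularity for the pair \<open>R - K\<close> and \<open>R\<close>; the
    bidder \<open>k\<close> lies in the smaller set because \<open>k\<close> is not in
    \<open>K\<close>.\<close>
  have "f (R - K) - f (R - K - {k}) \<le> f R - f (R - {k})"
    using f insert unfolding supermodular_def by (metis DiffI Diff_subset insert_subset)
  moreover have "R - insert k K = R - K - {k}" by blast
  ultimately show ?case using insert by simp
qed

text \<open>The hypothesis says that the marginal value of one bidder does not grow when one other
  bidder leaves. Any subset is reached by such single departures, so the claim follows by induction
  on the set \<open>K\<close> of departed bidders.\<close>

lemma supermodular_if_local:
  fixes f :: "'l::finite set \<Rightarrow> real"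
  assumes loc: "\<And>R i j. i \<in> R \<Longrightarrow> j \<in> R \<Longrightarrow> i \<noteq> j \<Longrightarrow> f (R - {i}) + f (R - {j}) \<le> f R + f (R - {i, j})"
  shows "supermodular f"
proof -
  have remove: "f (R - K) - f (R - K - {l}) \<le> f R - f (R - {l})" if "K \<subseteq> R - {l}" "l \<in> R" for K R l
    using finite[of K] that(1)
  proof (induction K rule: finite_induct)
    case empty
    then show ?case by simp
  next
    case (insert k K)
    \<comment> \<open>The hypothesis at \<open>R - K\<close>, rearranged: the marginal value of
      \<open>l\<close> does not increase when \<open>k\<close> leaves as well.\<close>
    have "f (R - K - {k}) + f (R - K - {l}) \<le> f (R - K) + f (R - K - {k, l})"
      using insert that by (intro loc) auto
    moreover have "R - insert k K = R - K - {k}" "R - insert k K - {l} = R - K - {k, l}" by blast+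
    ultimately show ?case using insert by (simp only:) simp
  qed
  have "f S - f (S - {l}) \<le> f R - f (R - {l})" if "S \<subseteq> R" "l \<in> S" for S R l
  proof -
    have "R - (R - S) = S" using that by blast
    then show ?thesis using remove[of "R - S" R l] that by auto
  qed
  then show ?thesis unfolding supermodular_def by blast
qed

lemma is_arg_min_arg_min:
  assumes "bid_profile d g C"
  shows "is_arg_min (cost d C S) (feasible g S) (arg_min (cost d C S) (feasible g S))"
  using assms unfolding bid_profile_def arg_min_def by (meson someI_ex)

text \<open>A minimiser for \<open>S\<close> stays feasible for \<open>R\<close> at the same cost,
  since the additional bidders are allocated 0 and bid 0 there. This makes the VCG utilities
  nonnegative.\<close>

lemma J_antimono:
  fixes d :: "real^'t::finite^'l::finite \<Rightarrow> real^'p::finite \<Rightarrow> real"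
    and g :: "real^'t^'l \<Rightarrow> real^'p \<Rightarrow> real^'q::finite"
  assumes C: "bid_profile d g C" and "S \<subseteq> R"
  shows "J d g C R \<le> J d g C S"
proof -
  obtain x y where xy: "arg_min (cost d C S) (feasible g S) = (x, y)" by fastforce
  have "feasible g S (x, y)"
    using is_arg_min_arg_min[OF C, of S] unfolding xy is_arg_min_def by simp
  then have feas: "feasible g R (x, y)" and zero: "\<And>l. l \<notin> S \<Longrightarrow> x $ l = 0"
    using \<open>S \<subseteq> R\<close> unfolding feasible_def by auto
  have "(\<Sum>l\<in>R. C l (x $ l)) = (\<Sum>l\<in>S. C l (x $ l))"
    using C zero \<open>S \<subseteq> R\<close> unfolding bid_profile_def by (intro sum.mono_neutral_right) auto
  then have "cost d C R (x, y) = J d g C S"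
    unfolding J_def xy by (simp add: cost_def)
  moreover have "J d g C R \<le> cost d C R (x, y)"
    using is_arg_min_arg_min[OF C, of R] feas unfolding is_arg_min_linorder J_def by blast
  ultimately show ?thesis by simp
qed

text \<open>The operator's utility is defined so that the efficiency equation holds, and
  \<open>J_antimono\<close> gives nonnegativity, so only the coalition inequalities remain. In these
  the utilities of \<open>S\<close> cancel, leaving those of the excluded bidders
  \<open>R - S\<close>.\<close>

lemma vcg_outcome_in_core_iff:
  fixes d :: "real^'t::finite^'l::finite \<Rightarrow> real^'p::finite \<Rightarrow> real"
    and g :: "real^'t^'l \<Rightarrow> real^'p \<Rightarrow> real^'q::finite"
  assumes C: "bid_profile d g C"
  shows "vcg_outcome d g C R \<in> core d g C R \<longleftrightarrow>
    (\<forall>S. S \<subset> R \<longrightarrow> (\<Sum>l\<in>R - S. J d g C (R - {l}) - J d g C R) \<le> J d g C S - J d g C R)"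
proof -
  define u where "u = (\<lambda>l\<in>R. J d g C (R - {l}) - J d g C R)"
  have "J d g C R \<le> J d g C (R - {l})" for l
    by (rule J_antimono[OF C]) blast
  then have u: "u \<in> R \<rightarrow>\<^sub>E {0..}" unfolding u_def by auto
  have "- J d g C R - sum u R + sum u S \<ge> - J d g C S \<longleftrightarrow>
      (\<Sum>l\<in>R - S. J d g C (R - {l}) - J d g C R) \<le> J d g C S - J d g C R" if "S \<subset> R" for S
  proof -
    have "sum u R = sum u (R - S) + sum u S"
      using that by (intro sum.subset_diff) auto
    moreover have "sum u (R - S) = (\<Sum>l\<in>R - S. J d g C (R - {l}) - J d g C R)"
      unfolding u_def by (intro sum.cong) auto
    ultimately show ?thesis by linarith
  qed
  moreover have "vcg_outcome d g C R = (- J d g C R - sum u R, u)"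
    unfolding vcg_outcome_def u_def Let_def by simp
  ultimately show ?thesis using u unfolding core_def by auto
qed

lemma vcg_outcomes_in_core_iff_supermodular:
  fixes d :: "real^'t::finite^'l::finite \<Rightarrow> real^'p::finite \<Rightarrow> real"
    and g :: "real^'t^'l \<Rightarrow> real^'p \<Rightarrow> real^'q::finite"
  assumes C: "bid_profile d g C"
  shows "(\<forall>R. vcg_outcome d g C R \<in> core d g C R) \<longleftrightarrow> supermodular (J d g C)"
proof
  assume core: "\<forall>R. vcg_outcome d g C R \<in> core d g C R"
  show "supermodular (J d g C)"
  proof (rule supermodular_if_local)
    fix R and i j :: 'l
    assume ij: "i \<in> R" "j \<in> R" "i \<noteq> j"
    then have "R - {i, j} \<subset> R" "R - (R - {i, j}) = {i, j}" by blast+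
    then have "(\<Sum>l\<in>{i, j}. J d g C (R - {l}) - J d g C R) \<le> J d g C (R - {i, j}) - J d g C R"
      using core vcg_outcome_in_core_iff[OF C, of R] by metis
    \<comment> \<open>The two-term sum subtracts \<open>J d g C R\<close> twice, and the right-hand
      side cancels one of these copies.\<close>
    then show "J d g C (R - {i}) + J d g C (R - {j}) \<le> J d g C R + J d g C (R - {i, j})"
      using ij by simp
  qed
next
  assume super: "supermodular (J d g C)"
  have "(\<Sum>l\<in>R - S. J d g C (R - {l}) - J d g C R) \<le> J d g C S - J d g C R" if "S \<subset> R" for R S
  proof -
    \<comment> \<open>The bidders to remove one by one are those outside the coalition, so
      \<open>K\<close> is taken to be \<open>R - S\<close>.\<close>
    have "R - (R - S) = S" using that by blast
    then show ?thesis using supermodular_sum_marginal_le[OF super, of "R - S" R] by simp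
  qed
  then show "\<forall>R. vcg_outcome d g C R \<in> core d g C R"
    using vcg_outcome_in_core_iff[OF C] by blast
qed

theorem theorem2:
  fixes d :: "real^'t::finite^'l::finite \<Rightarrow> real^'p::finite \<Rightarrow> real"
    and g :: "real^'t^'l \<Rightarrow> real^'p \<Rightarrow> real^'q::finite"
  shows "(\<forall>C R. bid_profile d g C \<longrightarrow> vcg_outcome d g C R \<in> core d g C R) \<longleftrightarrow>
         (\<forall>C. bid_profile d g C \<longrightarrow> supermodular (\<lambda>S. J d g C S))"
  using vcg_outcomes_in_core_iff_supermodular by blast

end
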